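(* Let $r,n,k$ be positive integers with $r<n$ and $1\le k\le n^2$, and let $\boldsymbol{\rho}=(\rho_1,\dots,\rho_k)$ be integers with $1\le\rho_\ell\le n^2$ and $\sum_{\ell\in[k]}\rho_\ell=n^2$. An $r\times n$ equitable $\boldsymbol{\rho}$-Latin rectangle $M$ extends to an $n\times n$ equitable $\boldsymbol{\rho}$-Latin square if and only if both of the following hold: $$\frac{\rho_\ell-|M_\ell|}{n-r}\approx\frac{\rho_\ell}{n}\quad\text{for all }\ell\in[k],$$ $$n|J|\ \ge\ \sum_{\ell\in[k]}\Big(|J|\left\lceil\frac{\rho_\ell}{n}\right\rceil-\min\Big\{n\left\lceil\frac{\rho_\ell}{n}\right\rceil-\rho_\ell,\ \eta_J(\ell)\Big\}\Big)\quad\text{for all }J\subseteq[n].$$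
   Context: $[m]=\{1,\dots,m\}$. For real $x,y$, $x\approx y$ means $\lfloor y\rfloor\le x\le\lceil y\rceil$. An $r\times s$ array on $[k]$ has rows indexed by $[r]$ and columns indexed by $[s]$, and each cell contains exactly one symbol from $[k]$. $|M_\ell|$, $|M_\ell^i|$, $|{}^jM_\ell|$ denote the number of occurrences of symbol $\ell$ in $M$, in row $i$ of $M$, and in column $j$ of $M$, respectively. Equitable $\boldsymbol{\rho}$-Latin rectangle: an $r\times s$ array $M$ on $[k]$ (with $r,s\le n$) such that for all $\ell\in[k]$, $i\in[r]$, $j\in[s]$: $|M_\ell^i|\le\lceil\rho_\ell/n\rceil$, $|{}^jM_\ell|\le\lceil\rho_\ell/n\rceil$, $|M_\ell|\le\rho_\ell$; moreover if $s=n$ (rows are full) then $|M_\ell^i|\ge\lfloor\rho_\ell/n\rfloor$; if $r=n$ (columns are full) then $|{}^jM_\ell|\ge\lfloor\rho_\ell/n\rfloor$; and if $r=s=n$ then $|M_\ell|=\rho_\ell$. When $r=s=n$ it is called an equitable $\boldsymbol{\rho}$-Latin square. $M$ extends to an $n\times n$ array $N$ if the top-left $r\times s$ subarray of $N$ is $M$. A symbol $\ell$ is free if $n\nmid\rho_\ell$, and forced otherwise. A column $j$ of $M$ is $\ell$-saturated if $\ell$ appears exactly $\lceil\rho_\ell/n\rceil$ times in it, and $\ell$-unsaturated otherwise. For a set $J$ of columns, $\eta_J(\ell)$ is the number of $\ell$-unsaturated columns of $M$ in $J$ if $\ell$ is free, and $\eta_J(\ell)=0$ if $\ell$ is forced.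 *)

theory Defs
  imports Complex_Main
begin

text \<open>Arrays are functions from row and column indices, counted from 1; only the values on
  \<open>{1..r} \<times> {1..s}\<close> are relevant. A vector \<open>(\<rho>\<^sub>1, \<dots>, \<rho>\<^sub>k)\<close> is a function of which only the
  values on \<open>{1..k}\<close> are relevant.\<close>

definition approx_eq :: "real \<Rightarrow> real \<Rightarrow> bool" (infix "\<approx>" 50) where
  "x \<approx> y \<longleftrightarrow> real_of_int \<lfloor>y\<rfloor> \<le> x \<and> x \<le> real_of_int \<lceil>y\<rceil>"

definition is_array :: "nat \<Rightarrow> nat \<Rightarrow> nat \<Rightarrow> (nat \<Rightarrow> nat \<Rightarrow> nat) \<Rightarrow> bool" where
  "is_array r s k M \<longleftrightarrow> (\<forall>i\<in>{1..r}. \<forall>j\<in>{1..s}. M i j \<in> {1..k})"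

definition occ :: "nat \<Rightarrow> nat \<Rightarrow> (nat \<Rightarrow> nat \<Rightarrow> nat) \<Rightarrow> nat \<Rightarrow> nat" where
  "occ r s M l = card {(i, j). i \<in> {1..r} \<and> j \<in> {1..s} \<and> M i j = l}"

definition row_occ :: "nat \<Rightarrow> (nat \<Rightarrow> nat \<Rightarrow> nat) \<Rightarrow> nat \<Rightarrow> nat \<Rightarrow> nat" where
  "row_occ s M i l = card {j \<in> {1..s}. M i j = l}"

definition col_occ :: "nat \<Rightarrow> (nat \<Rightarrow> nat \<Rightarrow> nat) \<Rightarrow> nat \<Rightarrow> nat \<Rightarrow> nat" where
  "col_occ r M j l = card {i \<in> {1..r}. M i j = l}"

definition equitable_latin_rectangle ::
  "nat \<Rightarrow> nat \<Rightarrow> (nat \<Rightarrow> nat) \<Rightarrow> nat \<Rightarrow> nat \<Rightarrow> (nat \<Rightarrow> nat \<Rightarrow> nat) \<Rightarrow> bool" where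
  "equitable_latin_rectangle n k \<rho> r s M \<longleftrightarrow>
     r \<le> n \<and> s \<le> n \<and> is_array r s k M \<and>
     (\<forall>l\<in>{1..k}.
        (\<forall>i\<in>{1..r}. int (row_occ s M i l) \<le> \<lceil>real (\<rho> l) / real n\<rceil>) \<and>
        (\<forall>j\<in>{1..s}. int (col_occ r M j l) \<le> \<lceil>real (\<rho> l) / real n\<rceil>) \<and>
        occ r s M l \<le> \<rho> l \<and>
        (s = n \<longrightarrow> (\<forall>i\<in>{1..r}. \<lfloor>real (\<rho> l) / real n\<rfloor> \<le> int (row_occ s M i l))) \<and>
        (r = n \<longrightarrow> (\<forall>j\<in>{1..s}. \<lfloor>real (\<rho> l) / real n\<rfloor> \<le> int (col_occ r M j l))) \<and>
        (r = n \<and> s = n \<longrightarrow> occ r s M l = \<rho> l))"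

definition equitable_latin_square ::
  "nat \<Rightarrow> nat \<Rightarrow> (nat \<Rightarrow> nat) \<Rightarrow> (nat \<Rightarrow> nat \<Rightarrow> nat) \<Rightarrow> bool" where
  "equitable_latin_square n k \<rho> N \<longleftrightarrow> equitable_latin_rectangle n k \<rho> n n N"

definition extends_to ::
  "nat \<Rightarrow> nat \<Rightarrow> (nat \<Rightarrow> nat \<Rightarrow> nat) \<Rightarrow> (nat \<Rightarrow> nat \<Rightarrow> nat) \<Rightarrow> bool" where
  "extends_to r s M N \<longleftrightarrow> (\<forall>i\<in>{1..r}. \<forall>j\<in>{1..s}. N i j = M i j)"

definition free_symbol :: "nat \<Rightarrow> (nat \<Rightarrow> nat) \<Rightarrow> nat \<Rightarrow> bool" where
  "free_symbol n \<rho> l \<longleftrightarrow> \<not> n dvd \<rho> l"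

definition saturated ::
  "nat \<Rightarrow> (nat \<Rightarrow> nat) \<Rightarrow> nat \<Rightarrow> (nat \<Rightarrow> nat \<Rightarrow> nat) \<Rightarrow> nat \<Rightarrow> nat \<Rightarrow> bool" where
  "saturated n \<rho> r M l j \<longleftrightarrow> int (col_occ r M j l) = \<lceil>real (\<rho> l) / real n\<rceil>"

definition eta ::
  "nat \<Rightarrow> (nat \<Rightarrow> nat) \<Rightarrow> nat \<Rightarrow> (nat \<Rightarrow> nat \<Rightarrow> nat) \<Rightarrow> nat set \<Rightarrow> nat \<Rightarrow> nat" where
  "eta n \<rho> r M J l =
     (if free_symbol n \<rho> l then card {j \<in> J. \<not> saturated n \<rho> r M l j} else 0)"

end

theory Submission
  imports Defs
begin

text \<open>Write \<open>c\<^sub>l = \<lceil>\<rho>\<^sub>l / n\<rceil>\<close>. In an extension \<open>N\<close>, column \<open>j\<close> contains the symbol \<open>l\<close> exactly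
  \<open>c\<^sub>l - x\<^sub>j\<^sub>l\<close> times with \<open>x\<^sub>j\<^sub>l \<in> {0, 1}\<close>, where \<open>x\<^sub>j\<^sub>l = 1\<close> is possible only if \<open>l\<close> is free and \<open>j\<close>
  is \<open>l\<close>-unsaturated in \<open>M\<close>. So \<open>x\<close> is a subgraph of a bipartite graph with degree \<open>\<Sum>\<^sub>l c\<^sub>l - n\<close> at
  every column and \<open>n c\<^sub>l - \<rho>\<^sub>l\<close> at the symbol \<open>l\<close>, and the condition on the sets \<open>J\<close> is the cut
  condition for such a subgraph to exist. Conversely, \<open>x\<close> determines how often each symbol must be
  added to each column; this bipartite multigraph is split into \<open>n - r\<close> rows by repeatedly removing
  one entry per column in a balanced way, and the condition on \<open>\<rho>\<^sub>l - |M\<^sub>l|\<close> keeps every row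
  equitable.\<close>

section \<open>Bipartite subgraphs with prescribed degrees\<close>

text \<open>Union and intersection have the same total size as \<open>S\<close> and \<open>T\<close>
  but are at least as far apart, and capping at \<open>b\<close> is concave. This makes the capacity
  side of the cut condition submodular in the set of columns.\<close>

lemma min_card_submodular:
  fixes S T :: "'a set" and b :: nat
  assumes "finite S" "finite T"
  shows "min b (card (S \<union> T)) + min b (card (S \<inter> T)) \<le> min b (card S) + min b (card T)"
proof -
  have "card S + card T = card (S \<union> T) + card (S \<inter> T)"
    using assms by (rule card_Un_Int)
  moreover have "card (S \<inter> T) \<le> card S" "card (S \<inter> T) \<le> card T"
    using assms by (auto intro: card_mono)
  ultimately show ?thesis by linarith
qed

lemma sum_card_edges_swap:
  assumes "finite A" "finite B"
  shows "(\<Sum>j\<in>A. card {l\<in>B. P j l}) = (\<Sum>l\<in>B. card {j\<in>A. P j l})"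
proof -
  have *: "card {x\<in>S. Q x} = (\<Sum>x\<in>S. if Q x then 1 else 0)" if "finite S" for S :: "'z set" and Q
    using that by (simp add: sum.If_cases Int_def)
  show ?thesis
    using assms by (simp add: * sum.swap[of _ A B])
qed

text \<open>In an edge-minimal graph satisfying the cut condition, every edge at \<open>j\<close> is witnessed by a
  tight set containing \<open>j\<close>. Tight sets are closed under intersection by submodularity, so the
  smallest tight set containing \<open>j\<close> witnesses all these edges at once, which bounds the degree
  of \<open>j\<close> by its demand.\<close>

theorem degree_constrained_subgraph:
  fixes A :: "'a set" and B :: "'b set" and a :: "'a \<Rightarrow> nat" and b :: "'b \<Rightarrow> nat"
  assumes "finite A" "finite B" "E \<subseteq> A \<times> B"
    and "\<And>J. J \<subseteq> A \<Longrightarrow> sum a J \<le> (\<Sum>l\<in>B. min (b l) (card {j\<in>J. (j, l) \<in> E}))"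
  shows "\<exists>X\<subseteq>E. (\<forall>j\<in>A. card {l\<in>B. (j, l) \<in> X} = a j) \<and> (\<forall>l\<in>B. card {j\<in>A. (j, l) \<in> X} \<le> b l)"
  using assms(3,4)
proof (induction "card E" arbitrary: E rule: less_induct)
  case less
  note fin = assms(1,2)
  have finE: "finite E"
    using less.prems(1) fin finite_subset by blast
  \<comment> \<open>The capacity side of the cut condition, with the graph as a parameter so that
    graphs before and after deletion of an edge can be compared.\<close>
  define g where "g F J = (\<Sum>l\<in>B. min (b l) (card {j\<in>J. (j, l) \<in> F}))"
    for F :: "('a \<times> 'b) set" and J
  have cut: "sum a J \<le> g E J" if "J \<subseteq> A" for J
    using less.prems(2)[OF that] by (simp add: g_def)
  show ?case
  proof (cases "\<exists>e\<in>E. \<forall>J. J \<subseteq> A \<longrightarrow> sum a J \<le> g (E - {e}) J")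
    case True
    then obtain e where e: "e \<in> E" "\<And>J. J \<subseteq> A \<Longrightarrow> sum a J \<le> g (E - {e}) J"
      by blast
    have "card (E - {e}) < card E"
      using finE e(1) by (rule card_Diff1_less)
    moreover have "E - {e} \<subseteq> A \<times> B"
      using less.prems(1) by blast
    ultimately have "\<exists>X\<subseteq>E - {e}. (\<forall>j\<in>A. card {l\<in>B. (j, l) \<in> X} = a j) \<and>
        (\<forall>l\<in>B. card {j\<in>A. (j, l) \<in> X} \<le> b l)"
      by (rule less.hyps) (use e(2) in \<open>simp add: g_def\<close>)
    then show ?thesis by blast
  next
    case False
    define tight where "tight J \<longleftrightarrow> J \<subseteq> A \<and> g E J = sum a J" for J
    have finJ: "finite J" if "J \<subseteq> A" for J
      using that fin(1) finite_subset by blast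
    \<comment> \<open>Deleting one edge lowers \<open>g\<close> by at most one, so a set violated by
      the deletion was tight before. The value drops only if the edge starts in \<open>J\<close> and
      the cap \<open>b l\<close> does not already absorb the loss.\<close>
    have witness: "\<exists>J. tight J \<and> j \<in> J \<and> card {i\<in>J. (i, l) \<in> E} \<le> b l" if "(j, l) \<in> E" for j l
    proof -
      from False that obtain J where J: "J \<subseteq> A" "g (E - {(j, l)}) J < sum a J"
        by (meson not_le)
      have l: "l \<in> B"
        using that less.prems(1) by blast
      define h where "h F l = min (b l) (card {i\<in>J. (i, l) \<in> F})" for F :: "('a \<times> 'b) set" and l
      have g_split: "g F J = h F l + sum (h F) (B - {l})" for F
        unfolding g_def h_def using fin(2) l by (rule sum.remove)
      have rest: "sum (h (E - {(j, l)})) (B - {l}) = sum (h E) (B - {l})"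
        by (rule sum.cong) (auto simp: h_def)
      then have less: "h (E - {(j, l)}) l < h E l"
        using g_split[of E] g_split[of "E - {(j, l)}"] J(2) cut[OF J(1)] by linarith
      have set: "{i\<in>J. (i, l) \<in> E - {(j, l)}} = {i\<in>J. (i, l) \<in> E} - {j}"
        by auto
      have j: "j \<in> J"
      proof (rule ccontr)
        assume "j \<notin> J"
        then have "h (E - {(j, l)}) l = h E l"
          unfolding h_def set by simp
        with less show False by simp
      qed
      then have "card {i\<in>J. (i, l) \<in> E} = Suc (card ({i\<in>J. (i, l) \<in> E} - {j}))"
        using finJ[OF J(1)] that by (intro card.remove) auto
      then have "h E l \<le> Suc (h (E - {(j, l)}) l)" "card {i\<in>J. (i, l) \<in> E} \<le> b l"
        using less unfolding h_def set by linarith+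
      moreover have "g E J = sum a J"
        using g_split[of E] g_split[of "E - {(j, l)}"] J(2) cut[OF J(1)] rest calculation(1)
        by linarith
      ultimately show ?thesis
        using J(1) j by (auto simp: tight_def)
    qed
    have tight_Int: "tight (S \<inter> T)" if "tight S" "tight T" for S T
    proof -
      have sub: "S \<subseteq> A" "T \<subseteq> A"
        using that by (auto simp: tight_def)
      have "g E (S \<union> T) + g E (S \<inter> T) \<le> g E S + g E T"
        unfolding g_def sum.distrib[symmetric]
      proof (rule sum_mono)
        fix l
        have "{j\<in>S \<union> T. (j, l) \<in> E} = {j\<in>S. (j, l) \<in> E} \<union> {j\<in>T. (j, l) \<in> E}"
          "{j\<in>S \<inter> T. (j, l) \<in> E} = {j\<in>S. (j, l) \<in> E} \<inter> {j\<in>T. (j, l) \<in> E}"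
          by auto
        then show "min (b l) (card {j\<in>S \<union> T. (j, l) \<in> E}) + min (b l) (card {j\<in>S \<inter> T. (j, l) \<in> E})
            \<le> min (b l) (card {j\<in>S. (j, l) \<in> E}) + min (b l) (card {j\<in>T. (j, l) \<in> E})"
          using min_card_submodular[of "{j\<in>S. (j, l) \<in> E}" "{j\<in>T. (j, l) \<in> E}" "b l"]
            finJ[OF sub(1)] finJ[OF sub(2)] by simp
      qed
      moreover have "sum a (S \<union> T) + sum a (S \<inter> T) = sum a S + sum a T"
        using finJ sub by (simp add: sum.union_inter)
      moreover have "S \<union> T \<subseteq> A" "S \<inter> T \<subseteq> A"
        using sub by auto
      \<comment> \<open>The cut condition bounds the values at union and intersection from below,
        and the sum of these bounds is already attained, so both sets are tight.\<close>
      ultimately show ?thesis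
        using that cut[of "S \<union> T"] cut[of "S \<inter> T"] by (simp add: tight_def)
    qed
    have deg: "card {l\<in>B. (j, l) \<in> E} = a j" if j: "j \<in> A" for j
    proof (rule antisym)
      have "a j \<le> g E {j}"
        using cut[of "{j}"] j by simp
      also have "\<dots> \<le> (\<Sum>l\<in>B. card {i\<in>{j}. (i, l) \<in> E})"
        unfolding g_def by (rule sum_mono) simp
      also have "\<dots> = card {l\<in>B. (j, l) \<in> E}"
        using sum_card_edges_swap[of "{j}" B "\<lambda>i l. (i, l) \<in> E"] fin by simp
      finally show "a j \<le> card {l\<in>B. (j, l) \<in> E}" .
      show "card {l\<in>B. (j, l) \<in> E} \<le> a j"
      proof (cases "{l\<in>B. (j, l) \<in> E} = {}")
        case True
        show ?thesis unfolding True by simp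
      next
        case False
        then have "\<exists>J. tight J \<and> j \<in> J"
          using witness by blast
        then obtain J where J: "tight J" "j \<in> J" and
          least: "\<And>T. tight T \<Longrightarrow> j \<in> T \<Longrightarrow> card J \<le> card T"
          using ex_has_least_nat[of "\<lambda>J. tight J \<and> j \<in> J" _ card] by blast
        have JA: "J \<subseteq> A"
          using J by (simp add: tight_def)
        have J_sub: "J \<subseteq> T" if "tight T" "j \<in> T" for T
        proof -
          have "card J \<le> card (J \<inter> T)"
            using least tight_Int J that by blast
          then have "J \<inter> T = J"
            using finJ[OF JA] by (intro card_seteq) auto
          then show ?thesis by blast
        qed
        \<comment> \<open>\<open>J\<close> lies inside every tight set that witnesses an edge at
          \<open>j\<close>, so the cap \<open>b l\<close> is not exceeded within \<open>J\<close>
          for any neighbour \<open>l\<close> of \<open>j\<close>. Removing \<open>j\<close>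
          therefore costs exactly one unit per neighbour. Tightness of \<open>J\<close> and the cut
          condition for \<open>J - {j}\<close> then bound the degree by \<open>a j\<close>.\<close>
        have "g E J = g E (J - {j}) + (\<Sum>l\<in>B. if (j, l) \<in> E then 1 else 0)"
          unfolding g_def sum.distrib[symmetric]
        proof (rule sum.cong)
          fix l
          have set: "{i\<in>J - {j}. (i, l) \<in> E} = {i\<in>J. (i, l) \<in> E} - {j}"
            by auto
          show "min (b l) (card {i\<in>J. (i, l) \<in> E}) =
              min (b l) (card {i\<in>J - {j}. (i, l) \<in> E}) + (if (j, l) \<in> E then 1 else 0)"
          proof (cases "(j, l) \<in> E")
            case True
            then obtain T where T: "tight T" "j \<in> T" "card {i\<in>T. (i, l) \<in> E} \<le> b l"
              using witness by blast
            have "card {i\<in>J. (i, l) \<in> E} \<le> card {i\<in>T. (i, l) \<in> E}"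
              using J_sub[OF T(1,2)] T(1) finJ by (intro card_mono) (auto simp: tight_def)
            moreover have "card {i\<in>J. (i, l) \<in> E} = Suc (card ({i\<in>J. (i, l) \<in> E} - {j}))"
              using finJ[OF JA] J(2) True by (intro card.remove) auto
            ultimately show ?thesis
              unfolding set using T(3) True by simp
          next
            case False
            then show ?thesis unfolding set by simp
          qed
        qed simp
        also have "(\<Sum>l\<in>B. if (j, l) \<in> E then 1 else 0) = card {l\<in>B. (j, l) \<in> E}"
          using fin(2) by (simp add: sum.If_cases Int_def)
        finally have "g E J = g E (J - {j}) + card {l\<in>B. (j, l) \<in> E}" .
        moreover have "sum a J = a j + sum a (J - {j})"
          using finJ[OF JA] J(2) by (rule sum.remove)
        moreover have "sum a (J - {j}) \<le> g E (J - {j})"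
          using JA by (intro cut) auto
        ultimately show ?thesis
          using J(1) by (simp add: tight_def)
      qed
    qed
    have "card {j\<in>A. (j, l) \<in> E} \<le> b l" if l: "l \<in> B" for l
    proof (rule ccontr)
      assume "\<not> ?thesis"
      \<comment> \<open>An overloaded vertex would make the cap strict there, so
        \<open>g E A\<close> would fall below the number of edges, which is
        \<open>sum a A\<close>.\<close>
      then have "g E A < (\<Sum>l\<in>B. card {j\<in>A. (j, l) \<in> E})"
        unfolding g_def using l fin(2) by (intro sum_strict_mono_ex1 bexI[of _ l]) auto
      also have "\<dots> = (\<Sum>j\<in>A. card {l\<in>B. (j, l) \<in> E})"
        using sum_card_edges_swap[OF fin, of "\<lambda>j l. (j, l) \<in> E"] by simp
      also have "\<dots> = sum a A"
        by (rule sum.cong) (simp_all add: deg)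
      finally show False
        using cut[of A] by simp
    qed
    with deg show ?thesis by blast
  qed
qed

text \<open>Counting the edges of the subgraph from both sides gives
  \<open>sum a A = sum b B\<close>, so no upper bound on the side of \<open>B\<close> can be
  strict.\<close>

corollary perfect_degree_constrained_subgraph:
  fixes A :: "'a set" and B :: "'b set" and a :: "'a \<Rightarrow> nat" and b :: "'b \<Rightarrow> nat"
  assumes fin: "finite A" "finite B" and "E \<subseteq> A \<times> B" and total: "sum a A = sum b B"
    and "\<And>J. J \<subseteq> A \<Longrightarrow> sum a J \<le> (\<Sum>l\<in>B. min (b l) (card {j\<in>J. (j, l) \<in> E}))"
  shows "\<exists>X\<subseteq>E. (\<forall>j\<in>A. card {l\<in>B. (j, l) \<in> X} = a j) \<and> (\<forall>l\<in>B. card {j\<in>A. (j, l) \<in> X} = b l)"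
proof -
  obtain X where X: "X \<subseteq> E" "\<forall>j\<in>A. card {l\<in>B. (j, l) \<in> X} = a j"
      "\<forall>l\<in>B. card {j\<in>A. (j, l) \<in> X} \<le> b l"
    using degree_constrained_subgraph[OF fin assms(3,5)] by blast
  have "(\<Sum>l\<in>B. card {j\<in>A. (j, l) \<in> X}) = sum a A"
    using sum_card_edges_swap[OF fin, of "\<lambda>j l. (j, l) \<in> X"] X(2) by simp
  moreover have "(\<Sum>l\<in>B. card {j\<in>A. (j, l) \<in> X}) < sum b B"
    if "l \<in> B" "card {j\<in>A. (j, l) \<in> X} \<noteq> b l" for l
    using that X(3) fin(2) by (intro sum_strict_mono_ex1) (auto simp: order_less_le)
  ultimately have "\<forall>l\<in>B. card {j\<in>A. (j, l) \<in> X} = b l"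
    using total by force
  with X show ?thesis by blast
qed

section \<open>Balanced splitting of a bipartite multigraph\<close>

lemma card_option_Collect:
  assumes "finite A"
  shows "card {x \<in> insert None (Some ` A). P x} =
    card {j \<in> A. P (Some j)} + (if P None then 1 else 0)"
proof -
  have "{x \<in> insert None (Some ` A). P x} =
      Some ` {j \<in> A. P (Some j)} \<union> (if P None then {None} else {})"
    by auto
  moreover have "card (Some ` {j \<in> A. P (Some j)}) = card {j \<in> A. P (Some j)}"
    by (simp add: card_image)
  ultimately show ?thesis
    using assms by simp
qed

text \<open>The extra vertex \<open>None\<close> absorbs the slack between the numbers of selections and the upper
  bounds. Since it is joined by at most one edge to \<open>l\<close>, and only if \<open>lo l < hi l\<close>, making all
  upper bounds tight also enforces the lower bounds.\<close>

lemma balanced_selection: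
  fixes d :: "'a \<Rightarrow> 'b \<Rightarrow> nat" and lo hi :: "'b \<Rightarrow> nat"
  assumes fin: "finite A" "finite B" and "0 < m"
    and rows: "\<And>j. j \<in> A \<Longrightarrow> (\<Sum>l\<in>B. d j l) = m"
    and lo: "\<And>l. l \<in> B \<Longrightarrow> m * lo l \<le> (\<Sum>j\<in>A. d j l)"
    and hi: "\<And>l. l \<in> B \<Longrightarrow> (\<Sum>j\<in>A. d j l) \<le> m * hi l"
    and gap: "\<And>l. l \<in> B \<Longrightarrow> hi l \<le> Suc (lo l)"
  shows "\<exists>s. (\<forall>j\<in>A. s j \<in> B \<and> 0 < d j (s j)) \<and>
    (\<forall>l\<in>B. lo l \<le> card {j\<in>A. s j = l} \<and> card {j\<in>A. s j = l} \<le> hi l)"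
proof -
  define A' where "A' = insert None (Some ` A)"
  \<comment> \<open>Each \<open>Some j\<close> makes one selection; the demand of
    \<open>None\<close> is chosen so that the total demand equals \<open>sum hi B\<close>.\<close>
  define a where "a = case_option (sum hi B - card A) (\<lambda>_::'a. 1)"
  define E where "E = {(Some j, l) |j l. j \<in> A \<and> l \<in> B \<and> 0 < d j l} \<union> {(None, l) |l. l \<in> B \<and> lo l < hi l}"
  have total: "m * card K = (\<Sum>l\<in>B. \<Sum>j\<in>K. d j l)" if "K \<subseteq> A" for K
  proof -
    have "(\<Sum>l\<in>B. \<Sum>j\<in>K. d j l) = (\<Sum>j\<in>K. \<Sum>l\<in>B. d j l)"
      by (rule sum.swap)
    also have "\<dots> = (\<Sum>j\<in>K. m)"
      using that rows by (intro sum.cong) auto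
    finally show ?thesis by simp
  qed
  have "m * card A \<le> m * sum hi B"
    unfolding total[OF subset_refl] sum_distrib_left by (rule sum_mono) (rule hi)
  then have card_le: "card A \<le> sum hi B"
    using \<open>0 < m\<close> by simp
  have "\<exists>X\<subseteq>E. (\<forall>x\<in>A'. card {l\<in>B. (x, l) \<in> X} = a x) \<and> (\<forall>l\<in>B. card {x\<in>A'. (x, l) \<in> X} = hi l)"
  proof (rule perfect_degree_constrained_subgraph)
    show "finite A'" "finite B" "E \<subseteq> A' \<times> B"
      using fin by (auto simp: A'_def E_def)
    show "sum a A' = sum hi B"
      using fin card_le by (simp add: A'_def a_def sum.reindex)
    fix J assume J: "J \<subseteq> A'"
    define K where "K = {j\<in>A. Some j \<in> J}"
    have K: "K \<subseteq> A" "finite K"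
      using fin by (auto simp: K_def)
    have JK: "J = Some ` K \<union> (if None \<in> J then {None} else {})"
      using J by (auto simp: K_def A'_def)
    \<comment> \<open>\<open>e l\<close> counts the edge from \<open>None\<close> to
      \<open>l\<close> when \<open>None\<close> belongs to \<open>J\<close>; \<open>w\<close> below
      is the indicator of \<open>None\<close> in \<open>J\<close>.\<close>
    define e where "e l = (if None \<in> J \<and> lo l < hi l then 1 else 0 :: nat)" for l
    define w where "w = (if None \<in> J then 1 else 0 :: int)"
    have edges: "card {x\<in>J. (x, l) \<in> E} = card {j\<in>K. 0 < d j l} + e l" if "l \<in> B" for l
    proof -
      have "{x\<in>J. (x, l) \<in> E} = {x\<in>A'. x \<in> J \<and> (x, l) \<in> E}"
        using J by auto
      moreover have "{j\<in>A. Some j \<in> J \<and> (Some j, l) \<in> E} = {j\<in>K. 0 < d j l}"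
        using that by (auto simp: K_def E_def)
      moreover have "(None, l) \<in> E \<longleftrightarrow> lo l < hi l"
        using that by (auto simp: E_def)
      ultimately show ?thesis
        using card_option_Collect[OF fin(1), of "\<lambda>x. x \<in> J \<and> (x, l) \<in> E"]
        by (simp add: A'_def e_def)
    qed
    \<comment> \<open>A fractional solution underlies this: weight \<open>d j l / m\<close> on the
      edge from \<open>Some j\<close> to \<open>l\<close>, and weight \<open>hi l\<close> minus the
      average \<open>(\<Sum>j\<in>A. d j l) / m\<close> on the edge from \<open>None\<close>. Each
      weight is at most 1 and the total at \<open>l\<close> is \<open>hi l\<close>, so the weight
      arriving from \<open>J\<close> respects both arguments of \<open>min\<close>. Everything is
      scaled by \<open>m\<close> to stay within the integers.\<close>
    have term_bound: "int (\<Sum>j\<in>K. d j l) + w * (int m * int (hi l) - int (\<Sum>j\<in>A. d j l))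
        \<le> int m * int (min (hi l) (card {x\<in>J. (x, l) \<in> E}))" if l: "l \<in> B" for l
    proof -
      have 1: "(\<Sum>j\<in>K. d j l) \<le> (\<Sum>j\<in>A. d j l)"
        using fin(1) K(1) by (rule sum_mono2) simp
      have "(\<Sum>j\<in>K. d j l) = (\<Sum>j\<in>{j\<in>K. 0 < d j l}. d j l)"
        using K by (intro sum.mono_neutral_right) auto
      also have "\<dots> \<le> (\<Sum>j\<in>{j\<in>K. 0 < d j l}. m)"
      proof (rule sum_mono)
        fix j assume "j \<in> {j\<in>K. 0 < d j l}"
        then have "j \<in> A" using K by auto
        show "d j l \<le> m"
          using member_le_sum[of l B "d j"] l fin rows[OF \<open>j \<in> A\<close>] by simp
      qed
      finally have 2: "(\<Sum>j\<in>K. d j l) \<le> m * card {j\<in>K. 0 < d j l}"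
        by (simp add: mult.commute)
      have "m * hi l \<le> m * lo l + m * (if lo l < hi l then 1 else 0)"
        unfolding add_mult_distrib2[symmetric] using gap[OF l] by (intro mult_left_mono) auto
      then have 3: "m * hi l \<le> (\<Sum>j\<in>A. d j l) + m * (if lo l < hi l then 1 else 0)"
        using lo[OF l] by linarith
      have *: "(\<Sum>j\<in>K. d j l) + nat w * (m * hi l) \<le> m * hi l + nat w * (\<Sum>j\<in>A. d j l)"
        "(\<Sum>j\<in>K. d j l) + nat w * (m * hi l) \<le> m * (card {j\<in>K. 0 < d j l} + e l) + nat w * (\<Sum>j\<in>A. d j l)"
        using 1 2 3 hi[OF l] by (auto simp: w_def e_def algebra_simps)
      have w: "w = int (nat w)"
        by (simp add: w_def)
      have "(\<Sum>j\<in>K. d j l) + nat w * (m * hi l) \<le> m * min (hi l) (card {j\<in>K. 0 < d j l} + e l) + nat w * (\<Sum>j\<in>A. d j l)"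
        using * by (simp add: min_def)
      then have "int (\<Sum>j\<in>K. d j l) + int (nat w) * (int m * int (hi l))
          \<le> int m * int (min (hi l) (card {j\<in>K. 0 < d j l} + e l)) + int (nat w) * int (\<Sum>j\<in>A. d j l)"
        by (simp only: of_nat_add[symmetric] of_nat_mult[symmetric] of_nat_le_iff)
      then show ?thesis
        unfolding edges[OF l] w[symmetric] by (simp add: algebra_simps)
    qed
    have "sum a J = card K + (if None \<in> J then sum hi B - card A else 0)"
      by (subst JK) (use K in \<open>auto simp: a_def sum.reindex\<close>)
    then have "int m * int (sum a J) = int (m * card K) + w * (int m * int (sum hi B) - int (m * card A))"
      using card_le by (simp add: w_def of_nat_diff algebra_simps)
    also have "\<dots> = (\<Sum>l\<in>B. int (\<Sum>j\<in>K. d j l) + w * (int m * int (hi l) - int (\<Sum>j\<in>A. d j l)))"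
      unfolding total[OF K(1)] total[OF subset_refl]
      by (simp add: sum.distrib sum_subtractf sum_distrib_left right_diff_distrib)
    also have "\<dots> \<le> (\<Sum>l\<in>B. int m * int (min (hi l) (card {x\<in>J. (x, l) \<in> E})))"
      by (rule sum_mono) (rule term_bound)
    also have "\<dots> = int m * int (\<Sum>l\<in>B. min (hi l) (card {x\<in>J. (x, l) \<in> E}))"
      by (simp add: sum_distrib_left)
    finally show "sum a J \<le> (\<Sum>l\<in>B. min (hi l) (card {x\<in>J. (x, l) \<in> E}))"
      using \<open>0 < m\<close> by (simp only: mult_le_cancel_left_pos of_nat_0_less_iff of_nat_le_iff)
  qed
  then obtain X where X: "X \<subseteq> E" "\<And>x. x \<in> A' \<Longrightarrow> card {l\<in>B. (x, l) \<in> X} = a x"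
      "\<And>l. l \<in> B \<Longrightarrow> card {x\<in>A'. (x, l) \<in> X} = hi l"
    by blast
  \<comment> \<open>Degree one at \<open>Some j\<close> turns the subgraph into a function on
    \<open>A\<close>.\<close>
  have "\<exists>t. {l\<in>B. (Some j, l) \<in> X} = {t}" if "j \<in> A" for j
    using X(2)[of "Some j"] that by (simp add: A'_def a_def card_1_singleton_iff)
  then obtain s where s: "\<And>j. j \<in> A \<Longrightarrow> {l\<in>B. (Some j, l) \<in> X} = {s j}"
    by metis
  have "s j \<in> B \<and> 0 < d j (s j)" if "j \<in> A" for j
  proof -
    have "s j \<in> B" "(Some j, s j) \<in> X"
      using s[OF that] by auto
    then show ?thesis
      using X(1) by (auto simp: E_def)
  qed
  moreover have "lo l \<le> card {j\<in>A. s j = l} \<and> card {j\<in>A. s j = l} \<le> hi l" if l: "l \<in> B" for l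
  proof -
    have "(Some j, l) \<in> X \<longleftrightarrow> s j = l" if "j \<in> A" for j
      using s[OF that, THEN eqset_imp_iff, of l] l by auto
    then have "{j\<in>A. (Some j, l) \<in> X} = {j\<in>A. s j = l}"
      by auto
    then have "hi l = card {j\<in>A. s j = l} + (if (None, l) \<in> X then 1 else 0)"
      using X(3)[OF l] card_option_Collect[OF fin(1), of "\<lambda>x. (x, l) \<in> X"] by (simp add: A'_def)
    moreover have "lo l < hi l" if "(None, l) \<in> X"
      using that X(1) by (auto simp: E_def)
    moreover have "lo l \<le> hi l"
      using order_trans[OF lo[OF l] hi[OF l]] \<open>0 < m\<close> by simp
    ultimately show ?thesis
      by (auto split: if_splits)
  qed
  ultimately show ?thesis by blast
qed

text \<open>Induction on the number of selections: remove one selection in which each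
  \<open>l\<close> occurs as often as the floor or the ceiling of its average. The remaining
  averages stay between the same floor and ceiling, hence between \<open>f l\<close> and
  \<open>c l\<close>, and the argument can be repeated.\<close>

lemma balanced_decomposition:
  fixes d :: "'a \<Rightarrow> 'b \<Rightarrow> nat" and f c :: "'b \<Rightarrow> nat"
  assumes fin: "finite A" "finite B"
    and "\<And>j. j \<in> A \<Longrightarrow> (\<Sum>l\<in>B. d j l) = m"
    and "\<And>l. l \<in> B \<Longrightarrow> m * f l \<le> (\<Sum>j\<in>A. d j l)"
    and "\<And>l. l \<in> B \<Longrightarrow> (\<Sum>j\<in>A. d j l) \<le> m * c l"
  shows "\<exists>s :: nat \<Rightarrow> 'a \<Rightarrow> 'b. (\<forall>i<m. \<forall>j\<in>A. s i j \<in> B) \<and>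
    (\<forall>i<m. \<forall>l\<in>B. f l \<le> card {j\<in>A. s i j = l} \<and> card {j\<in>A. s i j = l} \<le> c l) \<and>
    (\<forall>j\<in>A. \<forall>l\<in>B. card {i. i < m \<and> s i j = l} = d j l)"
  using assms(3-)
proof (induction m arbitrary: d)
  case 0
  then show ?case using fin by simp
next
  case (Suc m)
  define D where "D l = (\<Sum>j\<in>A. d j l)" for l
  define lo where "lo l = D l div Suc m" for l
  define hi where "hi l = (if Suc m dvd D l then lo l else Suc (lo l))" for l
  have D_eq: "D l = Suc m * lo l + D l mod Suc m" for l
    unfolding lo_def by (rule mult_div_mod_eq[symmetric])
  have D_mod: "D l mod Suc m < Suc m" for l
    by simp
  have lo_le: "Suc m * lo l \<le> D l" for l
    using D_eq[of l] by linarith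
  have hi_ge: "D l \<le> Suc m * hi l" for l
  proof (cases "Suc m dvd D l")
    case True
    then show ?thesis
      by (simp only: hi_def lo_def if_True dvd_mult_div_cancel order_refl)
  next
    case False
    then have "Suc m * hi l = Suc m + Suc m * lo l"
      by (simp only: hi_def if_False mult_Suc_right)
    then show ?thesis
      using D_eq[of l] D_mod[of l] by linarith
  qed
  have "\<exists>s. (\<forall>j\<in>A. s j \<in> B \<and> 0 < d j (s j)) \<and>
      (\<forall>l\<in>B. lo l \<le> card {j\<in>A. s j = l} \<and> card {j\<in>A. s j = l} \<le> hi l)"
    by (rule balanced_selection[OF fin, where m = "Suc m"])
      (use Suc.prems(1) lo_le hi_ge in \<open>auto simp: D_def hi_def simp del: mult_Suc\<close>)
  then obtain s0 where s0: "\<And>j. j \<in> A \<Longrightarrow> s0 j \<in> B" "\<And>j. j \<in> A \<Longrightarrow> 0 < d j (s0 j)"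
      "\<And>l. l \<in> B \<Longrightarrow> lo l \<le> card {j\<in>A. s0 j = l}" "\<And>l. l \<in> B \<Longrightarrow> card {j\<in>A. s0 j = l} \<le> hi l"
    by blast
  have f_le: "f l \<le> lo l" if "l \<in> B" for l
    using Suc.prems(2)[OF that] unfolding lo_def D_def
    by (metis less_eq_div_iff_mult_less_eq mult.commute zero_less_Suc)
  have c_ge: "hi l \<le> c l" if "l \<in> B" for l
  proof (rule ccontr)
    assume "\<not> hi l \<le> c l"
    moreover have "Suc m * lo l \<le> Suc m * c l"
      using order_trans[OF lo_le] Suc.prems(3)[OF that] unfolding D_def by blast
    then have "lo l \<le> c l"
      by (simp only: Suc_mult_le_cancel1)
    ultimately have "\<not> Suc m dvd D l" "c l = lo l"
      by (auto simp: hi_def split: if_splits)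
    then show False
      using Suc.prems(3)[OF that] D_eq[of l] by (simp add: D_def dvd_eq_mod_eq_0)
  qed
  \<comment> \<open>The truncated subtraction is exact, because \<open>s0\<close> selects only
    symbols of positive multiplicity.\<close>
  define d' where "d' j l = d j l - (if s0 j = l then 1 else 0)" for j l
  have d_eq: "d j l = d' j l + (if s0 j = l then 1 else 0)" if "j \<in> A" for j l
    using s0(2)[OF that] by (auto simp: d'_def)
  have D'_eq: "D l = (\<Sum>j\<in>A. d' j l) + card {j\<in>A. s0 j = l}" for l
    unfolding D_def using fin(1) by (simp add: d_eq sum.distrib sum.If_cases Int_def)
  have "\<exists>s :: nat \<Rightarrow> 'a \<Rightarrow> 'b. (\<forall>i<m. \<forall>j\<in>A. s i j \<in> B) \<and>
      (\<forall>i<m. \<forall>l\<in>B. f l \<le> card {j\<in>A. s i j = l} \<and> card {j\<in>A. s i j = l} \<le> c l) \<and>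
      (\<forall>j\<in>A. \<forall>l\<in>B. card {i. i < m \<and> s i j = l} = d' j l)"
  proof (rule Suc.IH)
    show "(\<Sum>l\<in>B. d' j l) = m" if "j \<in> A" for j
      using Suc.prems(1)[OF that] s0(1)[OF that] fin(2) by (simp add: d_eq[OF that] sum.distrib)
    fix l assume l: "l \<in> B"
    have "m * f l \<le> m * lo l" "m * hi l \<le> m * c l"
      using f_le[OF l] c_ge[OF l] by (intro mult_left_mono; simp)+
    \<comment> \<open>If \<open>Suc m\<close> divides \<open>D l\<close>, exactly
      \<open>lo l\<close> copies are removed and \<open>m * lo l\<close> remain. Otherwise the
      remainder lies between 1 and \<open>m\<close>, so removing either \<open>lo l\<close> or
      \<open>Suc (lo l)\<close> copies leaves a total within the bounds.\<close>
    moreover have "m * lo l \<le> (\<Sum>j\<in>A. d' j l) \<and> (\<Sum>j\<in>A. d' j l) \<le> m * hi l"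
    proof (cases "Suc m dvd D l")
      case True
      then have "hi l = lo l" "D l = lo l + m * lo l"
        using D_eq[of l] by (simp_all add: hi_def)
      then show ?thesis
        using D'_eq[of l] s0(3,4)[OF l] by simp
    next
      case False
      then have "0 < D l mod Suc m" and "hi l = Suc (lo l)"
        by (simp_all add: hi_def dvd_eq_mod_eq_0)
      moreover have "m * hi l = m + m * lo l"
        using calculation(2) by simp
      ultimately show ?thesis
        using D_eq[of l] D_mod[of l] D'_eq[of l] s0(3,4)[OF l] mult_Suc[of m "lo l"] by linarith
    qed
    ultimately show "m * f l \<le> (\<Sum>j\<in>A. d' j l)" "(\<Sum>j\<in>A. d' j l) \<le> m * c l"
      by linarith+
  qed
  then obtain s :: "nat \<Rightarrow> 'a \<Rightarrow> 'b" where s: "\<forall>i<m. \<forall>j\<in>A. s i j \<in> B"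
      "\<forall>i<m. \<forall>l\<in>B. f l \<le> card {j\<in>A. s i j = l} \<and> card {j\<in>A. s i j = l} \<le> c l"
      "\<forall>j\<in>A. \<forall>l\<in>B. card {i. i < m \<and> s i j = l} = d' j l"
    by blast
  have "card {i. i < Suc m \<and> (s(m := s0)) i j = l} = d j l" if "j \<in> A" "l \<in> B" for j l
  proof -
    have "{i. i < Suc m \<and> (s(m := s0)) i j = l} =
        {i. i < m \<and> s i j = l} \<union> (if s0 j = l then {m} else {})"
      by (auto simp: less_Suc_eq)
    then show ?thesis
      using s(3) that by (simp add: d_eq)
  qed
  moreover have "f l \<le> card {j\<in>A. s0 j = l} \<and> card {j\<in>A. s0 j = l} \<le> c l" if "l \<in> B" for l
    using s0(3,4)[OF that] f_le[OF that] c_ge[OF that] by linarith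
  ultimately show ?case
    using s(1,2) s0(1) by (intro exI[of _ "s(m := s0)"]) (auto simp: less_Suc_eq)
qed

section \<open>Occurrence counts and the two conditions over the natural numbers\<close>

text \<open>The ceiling of \<open>p / n\<close> for positive \<open>n\<close>. The case split
  matches the distinction between forced and free symbols: the ceiling exceeds the floor exactly for
  free ones.\<close>

definition ceil_div :: "nat \<Rightarrow> nat \<Rightarrow> nat" where
  "ceil_div p n = (if n dvd p then p div n else Suc (p div n))"

lemma ceiling_divide_of_nat:
  assumes "0 < n"
  shows "\<lceil>real p / real n\<rceil> = int (ceil_div p n)"
proof (cases "n dvd p")
  case True
  then show ?thesis
    using assms by (auto simp: ceil_div_def)
next
  case False
  have "real p = real n * real (p div n) + real (p mod n)"
    by (metis mult_div_mod_eq of_nat_add of_nat_mult)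
  moreover have "0 < p mod n" "p mod n < n"
    using False assms by (auto simp: dvd_eq_mod_eq_0)
  ultimately show ?thesis
    using assms False by (auto simp: ceil_div_def ceiling_eq_iff field_simps)
qed

lemma ceil_div_bounds:
  assumes "0 < n"
  shows "n * (p div n) \<le> p" "p \<le> n * ceil_div p n" "ceil_div p n \<le> Suc (p div n)"
    "p div n \<le> ceil_div p n"
proof -
  show "n * (p div n) \<le> p" by simp
  show "p \<le> n * ceil_div p n"
  proof (cases "n dvd p")
    case True
    then show ?thesis by (simp add: ceil_div_def)
  next
    case False
    then have "n * ceil_div p n = n + n * (p div n)"
      by (simp add: ceil_div_def)
    then show ?thesis
      using mult_div_mod_eq[of n p] mod_less_divisor[OF assms, of p] by linarith
  qed
  show "ceil_div p n \<le> Suc (p div n)" "p div n \<le> ceil_div p n"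
    by (auto simp: ceil_div_def)
qed

text \<open>Ensures that the common column demand, the sum of the ceilings minus \<open>n\<close>,
  is not truncated.\<close>

lemma le_sum_ceil_div:
  assumes "0 < n" and total: "(\<Sum>l\<in>S. \<rho> l) = n\<^sup>2"
  shows "n \<le> (\<Sum>l\<in>S. ceil_div (\<rho> l) n)"
proof -
  have "n * n \<le> n * (\<Sum>l\<in>S. ceil_div (\<rho> l) n)"
    unfolding sum_distrib_left power2_eq_square[symmetric] total[symmetric]
    using assms(1) by (intro sum_mono ceil_div_bounds)
  then show ?thesis
    using assms(1) by simp
qed

lemma occ_eq_sum_row_occ: "occ r s M l = (\<Sum>i\<in>{1..r}. row_occ s M i l)"
proof -
  have "{(i, j). i \<in> {1..r} \<and> j \<in> {1..s} \<and> M i j = l} = (SIGMA i:{1..r}. {j\<in>{1..s}. M i j = l})"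
    by auto
  then show ?thesis
    by (simp add: occ_def row_occ_def)
qed

lemma occ_eq_sum_col_occ: "occ r s M l = (\<Sum>j\<in>{1..s}. col_occ r M j l)"
  unfolding occ_eq_sum_row_occ row_occ_def col_occ_def by (rule sum_card_edges_swap) simp_all

lemma sum_col_occ:
  assumes "is_array r s k M" "j \<in> {1..s}"
  shows "(\<Sum>l\<in>{1..k}. col_occ r M j l) = r"
proof -
  have "(\<Sum>l\<in>{1..k}. card {i\<in>{1..r}. M i j = l}) = (\<Sum>i\<in>{1..r}. card {l\<in>{1..k}. M i j = l})"
    by (rule sum_card_edges_swap[symmetric]) simp_all
  also have "\<dots> = (\<Sum>i\<in>{1..r}. 1)"
  proof (rule sum.cong)
    fix i assume "i \<in> {1..r}"
    then have "{l\<in>{1..k}. M i j = l} = {M i j}"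
      using assms by (auto simp: is_array_def)
    then show "card {l\<in>{1..k}. M i j = l} = 1" by simp
  qed simp
  finally show ?thesis by (simp add: col_occ_def)
qed

lemma equitable_latin_rectangle_iff_nat:
  assumes "0 < n"
  shows "equitable_latin_rectangle n k \<rho> r s M \<longleftrightarrow>
     r \<le> n \<and> s \<le> n \<and> is_array r s k M \<and>
     (\<forall>l\<in>{1..k}.
        (\<forall>i\<in>{1..r}. row_occ s M i l \<le> ceil_div (\<rho> l) n) \<and>
        (\<forall>j\<in>{1..s}. col_occ r M j l \<le> ceil_div (\<rho> l) n) \<and>
        occ r s M l \<le> \<rho> l \<and>
        (s = n \<longrightarrow> (\<forall>i\<in>{1..r}. \<rho> l div n \<le> row_occ s M i l)) \<and>
        (r = n \<longrightarrow> (\<forall>j\<in>{1..s}. \<rho> l div n \<le> col_occ r M j l)) \<and>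
        (r = n \<and> s = n \<longrightarrow> occ r s M l = \<rho> l))"
  unfolding equitable_latin_rectangle_def ceiling_divide_of_nat[OF assms] floor_divide_of_nat_eq
    of_nat_le_iff ..

lemma approx_eq_iff_nat:
  assumes "r < n" "q \<le> p"
  shows "(real p - real q) / (real n - real r) \<approx> real p / real n \<longleftrightarrow>
    (n - r) * (p div n) \<le> p - q \<and> p - q \<le> (n - r) * ceil_div p n"
proof -
  have "0 < n" using assms by simp
  have *: "real p - real q = real (p - q)" "real n - real r = real (n - r)"
    using assms by simp_all
  have "real x \<le> real (p - q) / real (n - r) \<longleftrightarrow> (n - r) * x \<le> p - q"
    "real (p - q) / real (n - r) \<le> real x \<longleftrightarrow> p - q \<le> (n - r) * x" for x
    using assms(1) by (simp_all only: pos_le_divide_eq pos_divide_le_eq of_nat_0_less_iff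
        zero_less_diff mult.commute of_nat_mult[symmetric] of_nat_le_iff)
  then show ?thesis
    unfolding * approx_eq_def ceiling_divide_of_nat[OF \<open>0 < n\<close>] floor_divide_of_nat_eq of_int_of_nat_eq
    by simp
qed

text \<open>Rearranging the terms exposes the cut condition of the degree-constrained subgraph: the
  left side is the demand of the columns in \<open>J\<close>, the right side the capacity of the
  symbols towards \<open>J\<close>. Both truncated subtractions are exact.\<close>

lemma column_condition_iff_nat:
  assumes "0 < n" and total: "(\<Sum>l\<in>{1..k}. \<rho> l) = n\<^sup>2"
  shows "(\<Sum>l\<in>{1..k}. int (card J) * \<lceil>real (\<rho> l) / real n\<rceil> -
        min (int n * \<lceil>real (\<rho> l) / real n\<rceil> - int (\<rho> l)) (int (eta n \<rho> r M J l)))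
      \<le> int n * int (card J) \<longleftrightarrow>
    card J * ((\<Sum>l\<in>{1..k}. ceil_div (\<rho> l) n) - n)
      \<le> (\<Sum>l\<in>{1..k}. min (n * ceil_div (\<rho> l) n - \<rho> l) (eta n \<rho> r M J l))"
proof -
  let ?c = "\<lambda>l. ceil_div (\<rho> l) n"
  have le: "n \<le> sum ?c {1..k}"
    using assms by (rule le_sum_ceil_div)
  have "int n * int (?c l) - int (\<rho> l) = int (n * ?c l - \<rho> l)" for l
    using ceil_div_bounds(2)[OF assms(1)] by (simp add: of_nat_diff)
  then have "(\<Sum>l\<in>{1..k}. int (card J) * \<lceil>real (\<rho> l) / real n\<rceil> -
        min (int n * \<lceil>real (\<rho> l) / real n\<rceil> - int (\<rho> l)) (int (eta n \<rho> r M J l))) =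
      int (card J * sum ?c {1..k}) - int (\<Sum>l\<in>{1..k}. min (n * ?c l - \<rho> l) (eta n \<rho> r M J l))"
    unfolding ceiling_divide_of_nat[OF assms(1)]
    by (simp add: sum_subtractf sum_distrib_left flip: of_nat_min)
  moreover have "card J * (sum ?c {1..k} - n) = card J * sum ?c {1..k} - card J * n"
    by (rule diff_mult_distrib2)
  moreover have "int n * int (card J) = int (card J * n)"
    by simp
  ultimately show ?thesis
    using mult_le_mono2[OF le, of "card J"] by linarith
qed

lemma saturated_iff_nat:
  "0 < n \<Longrightarrow> saturated n \<rho> r M l j \<longleftrightarrow> col_occ r M j l = ceil_div (\<rho> l) n"
  by (simp add: saturated_def ceiling_divide_of_nat)

text \<open>With the freeness test moved into the set, \<open>eta\<close> becomes the number of
  neighbours of \<open>l\<close> in \<open>J\<close> in the graph of free symbols and unsaturated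
  columns.\<close>

lemma eta_eq_card:
  "eta n \<rho> r M J l = card {j\<in>J. free_symbol n \<rho> l \<and> \<not> saturated n \<rho> r M l j}"
  by (simp add: eta_def)

section \<open>Necessity and sufficiency of the conditions\<close>

text \<open>The first claim counts \<open>l\<close> in the \<open>n - r\<close> added rows, each of
  which is equitable. The second sums the column deficits of \<open>N\<close> over \<open>J\<close>
  in two ways.\<close>

lemma extension_necessary:
  assumes "r < n"
    and N: "equitable_latin_square n k \<rho> N" and ext: "extends_to r n M N"
  shows "l \<in> {1..k} \<Longrightarrow> (n - r) * (\<rho> l div n) \<le> \<rho> l - occ r n M l \<and>
      \<rho> l - occ r n M l \<le> (n - r) * ceil_div (\<rho> l) n"
    and "J \<subseteq> {1..n} \<Longrightarrow> card J * ((\<Sum>l\<in>{1..k}. ceil_div (\<rho> l) n) - n)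
      \<le> (\<Sum>l\<in>{1..k}. min (n * ceil_div (\<rho> l) n - \<rho> l) (eta n \<rho> r M J l))"
proof -
  let ?c = "\<lambda>l. ceil_div (\<rho> l) n"
  have n: "0 < n" using assms(1) by simp
  note N' = N[unfolded equitable_latin_square_def equitable_latin_rectangle_iff_nat[OF n]]
  {
    assume l: "l \<in> {1..k}"
    have "occ r n M l = (\<Sum>i\<in>{1..r}. row_occ n N i l)"
      unfolding occ_eq_sum_row_occ
    proof (rule sum.cong)
      fix i assume "i \<in> {1..r}"
      then have "{j\<in>{1..n}. M i j = l} = {j\<in>{1..n}. N i j = l}"
        using ext by (auto simp: extends_to_def)
      then show "row_occ n M i l = row_occ n N i l"
        by (simp add: row_occ_def)
    qed simp
    moreover have "\<rho> l = (\<Sum>i\<in>{1..n}. row_occ n N i l)"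
      unfolding occ_eq_sum_row_occ[symmetric] using N' l by simp
    moreover have split: "{1..n} = {1..r} \<union> {Suc r..n}"
      using assms(1) by auto
    have "(\<Sum>i\<in>{1..n}. row_occ n N i l) =
        (\<Sum>i\<in>{1..r}. row_occ n N i l) + (\<Sum>i\<in>{Suc r..n}. row_occ n N i l)"
      unfolding split by (rule sum.union_disjoint) auto
    ultimately have bottom: "\<rho> l - occ r n M l = (\<Sum>i\<in>{Suc r..n}. row_occ n N i l)"
      by simp
    have "card {Suc r..n} * (\<rho> l div n) \<le> (\<Sum>i\<in>{Suc r..n}. row_occ n N i l)"
      using N' l sum_bounded_below[of "{Suc r..n}" "\<rho> l div n" "\<lambda>i. row_occ n N i l"] by simp
    moreover have "(\<Sum>i\<in>{Suc r..n}. row_occ n N i l) \<le> card {Suc r..n} * ?c l"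
      using N' l sum_bounded_above[of "{Suc r..n}" "\<lambda>i. row_occ n N i l" "?c l"] by simp
    ultimately show "(n - r) * (\<rho> l div n) \<le> \<rho> l - occ r n M l \<and> \<rho> l - occ r n M l \<le> (n - r) * ?c l"
      by (simp add: bottom)
  }
  {
    assume J: "J \<subseteq> {1..n}"
    then have finJ: "finite J" by (rule finite_subset) simp
    define x where "x j l = ?c l - col_occ n N j l" for j l
    have le: "col_occ n N j l \<le> ?c l" if "j \<in> {1..n}" "l \<in> {1..k}" for j l
      using N' that by simp
    \<comment> \<open>A full column of \<open>N\<close> has \<open>n\<close> entries, so its
      deficits add up to the same number in every column.\<close>
    have "(\<Sum>l\<in>{1..k}. x j l) = sum ?c {1..k} - n" if "j \<in> J" for j
      unfolding x_def using J that le sum_col_occ[of n n k N j] N'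
      by (subst sum_subtractf_nat) auto
    then have "card J * (sum ?c {1..k} - n) = (\<Sum>j\<in>J. \<Sum>l\<in>{1..k}. x j l)"
      by simp
    also have "\<dots> = (\<Sum>l\<in>{1..k}. \<Sum>j\<in>J. x j l)"
      by (rule sum.swap)
    also have "\<dots> \<le> (\<Sum>l\<in>{1..k}. min (n * ?c l - \<rho> l) (eta n \<rho> r M J l))"
    proof (rule sum_mono)
      fix l assume l: "l \<in> {1..k}"
      have "(\<Sum>j\<in>J. x j l) \<le> (\<Sum>j\<in>{1..n}. x j l)"
        using J by (intro sum_mono2) auto
      also have "\<dots> = n * ?c l - occ n n N l"
        unfolding x_def occ_eq_sum_col_occ using le l by (subst sum_subtractf_nat) auto
      finally have "(\<Sum>j\<in>J. x j l) \<le> n * ?c l - \<rho> l"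
        using N' l by simp
      \<comment> \<open>The lower bound on the columns of \<open>N\<close> leaves a deficit of at
        most 1, and none for a forced symbol. A column saturated in \<open>M\<close> already holds
        the maximal number of copies, so it has no deficit either.\<close>
      moreover have "(\<Sum>j\<in>J. x j l) \<le> (\<Sum>j\<in>J. if free_symbol n \<rho> l \<and> \<not> saturated n \<rho> r M l j then 1 else 0)"
      proof (rule sum_mono)
        fix j assume "j \<in> J"
        then have j: "j \<in> {1..n}" using J by blast
        have "{i\<in>{1..r}. M i j = l} \<subseteq> {i\<in>{1..n}. N i j = l}"
          using ext j assms(1) by (auto simp: extends_to_def)
        then have "col_occ r M j l \<le> col_occ n N j l"
          unfolding col_occ_def by (intro card_mono) auto
        moreover have "\<rho> l div n \<le> col_occ n N j l"
          using N' j l by simp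
        ultimately show "x j l \<le> (if free_symbol n \<rho> l \<and> \<not> saturated n \<rho> r M l j then 1 else 0)"
          using le[OF j l] by (auto simp: x_def saturated_iff_nat[OF n] free_symbol_def ceil_div_def)
      qed
      then have "(\<Sum>j\<in>J. x j l) \<le> eta n \<rho> r M J l"
        unfolding eta_eq_card using finJ by (simp add: sum.If_cases Int_def)
      ultimately show "(\<Sum>j\<in>J. x j l) \<le> min (n * ?c l - \<rho> l) (eta n \<rho> r M J l)"
        by simp
    qed
    finally show "card J * (sum ?c {1..k} - n)
      \<le> (\<Sum>l\<in>{1..k}. min (n * ?c l - \<rho> l) (eta n \<rho> r M J l))" .
  }
qed

text \<open>The deficits are fixed first, by a subgraph with perfect degrees; what each column still
  lacks is then distributed over the \<open>n - r\<close> new rows by the balanced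
  decomposition.\<close>

lemma extension_sufficient:
  assumes "r < n" and total: "(\<Sum>l\<in>{1..k}. \<rho> l) = n\<^sup>2"
    and M: "equitable_latin_rectangle n k \<rho> r n M"
    and rows: "\<And>l. l \<in> {1..k} \<Longrightarrow> (n - r) * (\<rho> l div n) \<le> \<rho> l - occ r n M l \<and>
      \<rho> l - occ r n M l \<le> (n - r) * ceil_div (\<rho> l) n"
    and columns: "\<And>J. J \<subseteq> {1..n} \<Longrightarrow> card J * ((\<Sum>l\<in>{1..k}. ceil_div (\<rho> l) n) - n)
      \<le> (\<Sum>l\<in>{1..k}. min (n * ceil_div (\<rho> l) n - \<rho> l) (eta n \<rho> r M J l))"
  shows "\<exists>N. equitable_latin_square n k \<rho> N \<and> extends_to r n M N"
proof -
  let ?A = "{1..n}" and ?B = "{1..k}"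
  define c where "c l = ceil_div (\<rho> l) n" for l
  have n: "0 < n" using assms(1) by simp
  note M' = M[unfolded equitable_latin_rectangle_iff_nat[OF n], folded c_def]
  have \<rho>_le: "\<rho> l \<le> n * c l" for l
    unfolding c_def using n by (rule ceil_div_bounds)
  define E where "E = {(j, l). j \<in> ?A \<and> l \<in> ?B \<and> free_symbol n \<rho> l \<and> \<not> saturated n \<rho> r M l j}"
  \<comment> \<open>The hypothesis that the \<open>\<rho> l\<close> sum to \<open>n\<^sup>2\<close>
    makes the deficits demanded by symbols and by columns agree in total.\<close>
  have sum_b: "(\<Sum>l\<in>?B. n * c l - \<rho> l) = n * (sum c ?B - n)"
  proof -
    have "(\<Sum>l\<in>?B. n * c l - \<rho> l) = (\<Sum>l\<in>?B. n * c l) - (\<Sum>l\<in>?B. \<rho> l)"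
      using \<rho>_le by (intro sum_subtractf_nat) simp
    then show ?thesis
      unfolding total power2_eq_square diff_mult_distrib2 sum_distrib_left[symmetric] .
  qed
  have "\<exists>X\<subseteq>E. (\<forall>j\<in>?A. card {l\<in>?B. (j, l) \<in> X} = sum c ?B - n) \<and>
      (\<forall>l\<in>?B. card {j\<in>?A. (j, l) \<in> X} = n * c l - \<rho> l)"
  proof (rule perfect_degree_constrained_subgraph)
    show "finite ?A" "finite ?B" "E \<subseteq> ?A \<times> ?B"
      by (auto simp: E_def)
    show "(\<Sum>j\<in>?A. sum c ?B - n) = (\<Sum>l\<in>?B. n * c l - \<rho> l)"
      unfolding sum_b by simp
    fix J assume J: "J \<subseteq> ?A"
    have "card {j\<in>J. (j, l) \<in> E} = eta n \<rho> r M J l" if "l \<in> ?B" for l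
      unfolding eta_eq_card using that J by (intro arg_cong[where f = card]) (auto simp: E_def)
    then show "(\<Sum>j\<in>J. sum c ?B - n) \<le> (\<Sum>l\<in>?B. min (n * c l - \<rho> l) (card {j\<in>J. (j, l) \<in> E}))"
      using columns[OF J] by (simp add: c_def)
  qed
  then obtain X where X: "X \<subseteq> E" "\<And>j. j \<in> ?A \<Longrightarrow> card {l\<in>?B. (j, l) \<in> X} = sum c ?B - n"
      "\<And>l. l \<in> ?B \<Longrightarrow> card {j\<in>?A. (j, l) \<in> X} = n * c l - \<rho> l"
    by blast
  define x where "x j l = (if (j, l) \<in> X then 1 else 0 :: nat)" for j l
  \<comment> \<open>The number of copies of \<open>l\<close> to be added to column \<open>j\<close>.
    Nothing is truncated, since edges of \<open>X\<close> occur only at unsaturated columns.\<close>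
  define d where "d j l = c l - col_occ r M j l - x j l" for j l
  have d: "col_occ r M j l + d j l + x j l = c l" if "j \<in> ?A" "l \<in> ?B" for j l
  proof -
    have "col_occ r M j l \<le> c l"
      using M' that by simp
    moreover have "col_occ r M j l \<noteq> c l" if "(j, l) \<in> X"
      using that X(1) by (auto simp: E_def saturated_iff_nat[OF n] c_def)
    ultimately show ?thesis
      by (auto simp: d_def x_def)
  qed
  \<comment> \<open>Only free symbols have a deficit, so giving up one copy from the ceiling never
    goes below the floor.\<close>
  have x_free: "\<rho> l div n + x j l \<le> c l" for j l
    using X(1) by (auto simp: x_def E_def free_symbol_def c_def ceil_div_def)
  have n_le: "n \<le> sum c ?B"
    unfolding c_def using n total by (rule le_sum_ceil_div)
  have col_sum: "(\<Sum>l\<in>?B. d j l) = n - r" if j: "j \<in> ?A" for j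
  proof -
    have "sum c ?B = (\<Sum>l\<in>?B. col_occ r M j l + d j l + x j l)"
      using d[OF j] by simp
    also have "\<dots> = r + (\<Sum>l\<in>?B. d j l) + (sum c ?B - n)"
      using sum_col_occ[of r n k M j] M' j X(2)[OF j]
      by (simp add: sum.distrib x_def sum.If_cases Int_def)
    finally show ?thesis
      using n_le by linarith
  qed
  have symbol_sum: "(\<Sum>j\<in>?A. d j l) = \<rho> l - occ r n M l" if l: "l \<in> ?B" for l
  proof -
    have "n * c l = (\<Sum>j\<in>?A. col_occ r M j l + d j l + x j l)"
      using d l by simp
    also have "\<dots> = occ r n M l + (\<Sum>j\<in>?A. d j l) + (n * c l - \<rho> l)"
      using X(3)[OF l] by (simp add: sum.distrib x_def sum.If_cases Int_def occ_eq_sum_col_occ)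
    finally show ?thesis
      using \<rho>_le[of l] by linarith
  qed
  have "\<exists>s :: nat \<Rightarrow> nat \<Rightarrow> nat. (\<forall>i<n - r. \<forall>j\<in>?A. s i j \<in> ?B) \<and>
      (\<forall>i<n - r. \<forall>l\<in>?B. \<rho> l div n \<le> card {j\<in>?A. s i j = l} \<and> card {j\<in>?A. s i j = l} \<le> c l) \<and>
      (\<forall>j\<in>?A. \<forall>l\<in>?B. card {i. i < n - r \<and> s i j = l} = d j l)"
    by (rule balanced_decomposition) (use col_sum symbol_sum rows in \<open>auto simp: c_def\<close>)
  then obtain s :: "nat \<Rightarrow> nat \<Rightarrow> nat" where
      s: "\<And>i j. i < n - r \<Longrightarrow> j \<in> ?A \<Longrightarrow> s i j \<in> ?B"
        "\<And>i l. i < n - r \<Longrightarrow> l \<in> ?B \<Longrightarrow>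
          \<rho> l div n \<le> card {j\<in>?A. s i j = l} \<and> card {j\<in>?A. s i j = l} \<le> c l"
        "\<And>j l. j \<in> ?A \<Longrightarrow> l \<in> ?B \<Longrightarrow> card {i. i < n - r \<and> s i j = l} = d j l"
    by blast
  \<comment> \<open>Rows of arrays are counted from 1 but selections from 0, so row
    \<open>Suc r\<close> is \<open>s 0\<close>.\<close>
  define N where "N i j = (if i \<le> r then M i j else s (i - Suc r) j)" for i j
  have array: "is_array n n k N"
    unfolding is_array_def
  proof (intro ballI)
    fix i j assume ij: "i \<in> ?A" "j \<in> ?A"
    show "N i j \<in> ?B"
    proof (cases "i \<le> r")
      case True
      then show ?thesis
        using M' ij by (simp add: N_def is_array_def)
    next
      case False
      then show ?thesis
        using s(1)[of "i - Suc r" j] ij by (simp add: N_def)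
    qed
  qed
  have row: "\<rho> l div n \<le> row_occ n N i l \<and> row_occ n N i l \<le> c l" if "i \<in> ?A" "l \<in> ?B" for i l
  proof (cases "i \<le> r")
    case True
    then have "row_occ n N i l = row_occ n M i l"
      by (simp add: row_occ_def N_def)
    then show ?thesis
      using M' that True by simp
  next
    case False
    then show ?thesis
      using s(2)[of "i - Suc r" l] that by (simp add: row_occ_def N_def)
  qed
  have col: "col_occ n N j l = col_occ r M j l + d j l" if "j \<in> ?A" "l \<in> ?B" for j l
  proof -
    have "{i\<in>?A. N i j = l} = {i\<in>{1..r}. M i j = l} \<union> (\<lambda>i. i + Suc r) ` {i. i < n - r \<and> s i j = l}"
      (is "?L = ?R")
    proof
      show "?L \<subseteq> ?R"
      proof
        fix i assume i: "i \<in> ?L"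
        show "i \<in> ?R"
        proof (cases "i \<le> r")
          case True
          then show ?thesis using i by (simp add: N_def)
        next
          case False
          then have "i = (i - Suc r) + Suc r" "i - Suc r \<in> {i. i < n - r \<and> s i j = l}"
            using i by (auto simp: N_def)
          then show ?thesis by blast
        qed
      qed
      show "?R \<subseteq> ?L"
        using assms(1) by (auto simp: N_def)
    qed
    moreover have "card ((\<lambda>i. i + Suc r) ` {i. i < n - r \<and> s i j = l}) = d j l"
      using s(3)[OF that] by (subst card_image) (simp_all add: inj_on_def)
    moreover have "{i\<in>{1..r}. M i j = l} \<inter> (\<lambda>i. i + Suc r) ` {i. i < n - r \<and> s i j = l} = {}"
      by auto
    ultimately show ?thesis
      by (simp add: col_occ_def card_Un_disjoint)
  qed
  have col_bounds: "\<rho> l div n \<le> col_occ n N j l \<and> col_occ n N j l \<le> c l" if "j \<in> ?A" "l \<in> ?B" for j l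
    using col[OF that] d[OF that] x_free[of l j] by linarith
  have "occ n n N l = \<rho> l" if l: "l \<in> ?B" for l
  proof -
    have "occ n n N l = occ r n M l + (\<Sum>j\<in>?A. d j l)"
      using col l by (simp add: occ_eq_sum_col_occ sum.distrib)
    also have "\<dots> = \<rho> l"
      using symbol_sum[OF l] M' l by simp
    finally show ?thesis .
  qed
  then have "equitable_latin_square n k \<rho> N"
    unfolding equitable_latin_square_def equitable_latin_rectangle_iff_nat[OF n] c_def[symmetric]
    using array row col_bounds by simp
  moreover have "extends_to r n M N"
    by (simp add: extends_to_def N_def)
  ultimately show ?thesis by blast
qed

theorem corollary1p4:
  fixes r n k :: nat and \<rho> :: "nat \<Rightarrow> nat" and M :: "nat \<Rightarrow> nat \<Rightarrow> nat"
  assumes "0 < r" and "r < n"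
    and "1 \<le> k" and "k \<le> n\<^sup>2"
    and "\<forall>l\<in>{1..k}. 1 \<le> \<rho> l \<and> \<rho> l \<le> n\<^sup>2"
    and "(\<Sum>l\<in>{1..k}. \<rho> l) = n\<^sup>2"
    and "equitable_latin_rectangle n k \<rho> r n M"
  shows "(\<exists>N. equitable_latin_square n k \<rho> N \<and> extends_to r n M N) \<longleftrightarrow>
    (\<forall>l\<in>{1..k}. (real (\<rho> l) - real (occ r n M l)) / (real n - real r) \<approx> real (\<rho> l) / real n) \<and>
    (\<forall>J. J \<subseteq> {1..n} \<longrightarrow>
       int n * int (card J) \<ge>
         (\<Sum>l\<in>{1..k}. int (card J) * \<lceil>real (\<rho> l) / real n\<rceil> -
            min (int n * \<lceil>real (\<rho> l) / real n\<rceil> - int (\<rho> l)) (int (eta n \<rho> r M J l))))"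
proof -
  have n: "0 < n" using assms(2) by simp
  have le: "occ r n M l \<le> \<rho> l" if "l \<in> {1..k}" for l
    using assms(7) that by (simp add: equitable_latin_rectangle_def)
  have rows: "(\<forall>l\<in>{1..k}. (real (\<rho> l) - real (occ r n M l)) / (real n - real r) \<approx> real (\<rho> l) / real n) \<longleftrightarrow>
      (\<forall>l\<in>{1..k}. (n - r) * (\<rho> l div n) \<le> \<rho> l - occ r n M l \<and>
        \<rho> l - occ r n M l \<le> (n - r) * ceil_div (\<rho> l) n)"
    using approx_eq_iff_nat[OF assms(2) le] by blast
  show ?thesis
    unfolding rows column_condition_iff_nat[OF n assms(6)]
    using extension_necessary[OF assms(2)] extension_sufficient[OF assms(2,6,7)] by blast
qed

end
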